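(* For integers $2\le k_0\le k_1$ (the choice $k_1=\infty$ is also valid), let $K=\{k_0,\dots,k_1\}$ and let $\{x_k\}_{k\in K}$ be the output sequence on $K$ of the inexact augmented Lagrangian method (iALM) described in the context. Let $\rho:=\sup_{k\in K}\|x_k\|$, assumed finite. Suppose that $f:\mathbb{R}^d\to\mathbb{R}$ and $A:\mathbb{R}^d\to\mathbb{R}^m$ satisfy, for some $\lambda_f,\lambda_A\ge0$, $$\|\nabla f(x)-\nabla f(x')\|\le\lambda_f\|x-x'\|,\qquad \|DA(x)-DA(x')\|\le\lambda_A\|x-x'\|\qquad\forall x,x'\in\mathbb{R}^d,$$ and let $$\lambda'_f=\max_{\|x\|\le\rho}\|\nabla f(x)\|,\qquad \lambda'_A=\max_{\|x\|\le\rho}\|DA(x)\|$$ be the (restricted) Lipschitz constants of $f$ and $A$. With $\nu>0$, assume that $$\nu\|A(x_k)\|\le\operatorname{dist}\Big(-DA(x_k)^\top A(x_k),\ \frac{\partial g(x_k)}{\beta_{k-1}}\Big)\qquad\text{for every }k\in K.$$ Let $y_{\max}=y_{\max}(x_1,y_0,\sigma_1):=\|y_0\|+c\,\|A(x_1)\|$, where $c$ is a constant with $c\ge\sum_{i=1}^{\infty}\frac{1}{i\log^2(i+1)}$. Then: (1) If a first-order solver is used in Step 2, then for every $k\in K$, $x_k$ is an $(\epsilon_{k,f},\beta_k)$ first-order stationary point with $$\epsilon_{k,f}=\frac{1}{\beta_{k-1}}\left(\frac{2(\lambda'_f+\lambda'_A y_{\max})(1+\lambda'_A\sigma_k)}{\nu}+1\right)=:\frac{Q(f,g,A,\sigma_1)}{\beta_{k-1}}.$$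 (2) If a second-order solver is used in Step 2 (which requires $g=0$), then for every $k\in K$, $x_k$ is an $(\epsilon_{k,f},\epsilon_{k,s},\beta_k)$ second-order stationary point with $\epsilon_{k,f}$ as in (1) and $$\epsilon_{k,s}=\epsilon_k+\sigma_k\sqrt m\,\lambda_A\frac{2\lambda'_f+2\lambda'_Ay_{\max}}{\nu\beta_{k-1}}=\frac{\nu+\sigma_k\sqrt m\,\lambda_A(2\lambda'_f+2\lambda'_Ay_{\max})}{\nu\beta_{k-1}}=:\frac{Q'(f,g,A,\sigma_1)}{\beta_{k-1}}.$$
   Context: Problem: minimize $f(x)+g(x)$ over $x\in\mathbb{R}^d$ subject to $A(x)=0$, where $f:\mathbb{R}^d\to\mathbb{R}$ is continuously differentiable and possibly nonconvex, $A:\mathbb{R}^d\to\mathbb{R}^m$ is a (differentiable) nonlinear operator, and $g:\mathbb{R}^d\to\mathbb{R}\cup\{\infty\}$ is convex with an easily computed proximal operator. $\|\cdot\|$ is the Euclidean norm on vectors and the spectral norm on matrices; $DA(x)\in\mathbb{R}^{m\times d}$ is the Jacobian of $A$; $\partial g(x)$ is the convex subdifferential and $\partial g(x)/\beta=\{z/\beta:z\in\partial g(x)\}$; $\operatorname{dist}(u,S)=\min_{z\in S}\|u-z\|$; $\lambda_{\min}$ is the smallest eigenvalue. Augmented Lagrangian: for $\beta>0$, $\mathcal{L}_\beta(x,y)=f(x)+\langle A(x),y\rangle+\frac\beta2\|A(x)\|^2$; $\nabla_x\mathcal{L}_\beta$ is its gradient in $x$ and $\nabla_{xx}\mathcal{L}_\beta$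 its Hessian in $x$ (in the second-order case this Hessian is understood to exist). The problem is equivalent to $\min_x\max_y\mathcal{L}_\beta(x,y)+g(x)$, and stationarity is understood for this minimax problem. Stationarity: $x$ is an $(\epsilon_f,\beta)$ first-order stationary point if there exists $y\in\mathbb{R}^m$ with $\operatorname{dist}(-\nabla_x\mathcal{L}_\beta(x,y),\partial g(x))\le\epsilon_f$ and $\|A(x)\|\le\epsilon_f$. When $g=0$, $x$ is an $(\epsilon_f,\epsilon_s,\beta)$ second-order stationary point if, in addition, $\lambda_{\min}(\nabla_{xx}\mathcal{L}_\beta(x,y))\ge-\epsilon_s$. Algorithm (iALM). Input: a non-decreasing, positive, unbounded sequence $\{\beta_k\}_{k\ge1}$ and stopping thresholds $\tau_f,\tau_s>0$. Initialization: $x_1\in\mathbb{R}^d$, $y_0\in\mathbb{R}^m$, dual step size $\sigma_1>0$, and $y_1=y_0+\sigma_1A(x_1)$. For $k=1,2,\dots$: Step 1: $\epsilon_{k+1}=1/\beta_k$. Step 2: obtain $x_{k+1}\in\mathbb{R}^d$ with $\operatorname{dist}(-\nabla_x\mathcal{L}_{\beta_k}(x_{k+1},y_k),\partial g(x_{k+1}))\le\epsilon_{k+1}$ (first-order solver); with a second-order solver (only if $g=0$), also $\lambda_{\min}(\nabla_{xx}\mathcal{L}_{\beta_k}(x_{k+1},y_k))\ge-\epsilon_{k+1}$. Step 3: $\sigma_{k+1}=\sigma_1\min\Big(\frac{\|A(x_1)\|\log^22}{\|A(x_{k+1})\|(k+1)\log^2(k+2)},1\Big)$. Step 4: $y_{k+1}=y_k+\sigma_{k+1}A(x_{k+1})$.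 Step 5: stop and return $x_{k+1}$ if $\operatorname{dist}(-\nabla_x\mathcal{L}_{\beta_k}(x_{k+1},y_k),\partial g(x_{k+1}))+\|A(x_{k+1})\|\le\tau_f$ and, for second-order stationarity, also $\lambda_{\min}(\nabla_{xx}\mathcal{L}_{\beta_k}(x_{k+1},y_k))\ge-\tau_s$.
   Formalization: The claim fails as stated for small β_{k0-1} or large σ_1; two conditions are added: 1/β_{k0-1} ≤ λ'_f + λ'_A y_max + ν (k0 large enough), and c ≥ σ_1 log²(2) Σ 1/(i log²(i+1)) in addition to c ≥ Σ 1/(i log²(i+1)). *)

theory Defs
  imports "HOL-Analysis.Analysis" "HOL-Library.Extended_Nat"
begin

definition gradient :: "('a::euclidean_space \<Rightarrow> real) \<Rightarrow> 'a \<Rightarrow> 'a" where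
  "gradient h x = (THE D. GDERIV h x :> D)"

definition hessian :: "(real^'d \<Rightarrow> real) \<Rightarrow> real^'d \<Rightarrow> real^'d^'d" where
  "hessian h x = jacobian (gradient h) (at x)"

(* The library's norm on matrices (real^'n^'m) is the Frobenius norm, hence the
   explicit operator norm. *)
definition spectral_norm :: "real^'n^'m \<Rightarrow> real" where
  "spectral_norm M = onorm ((*v) M)"

(* Meaningful for matrices having a real eigenvalue, in particular for symmetric ones. *)
definition min_eigenvalue :: "real^'n^'n \<Rightarrow> real" where
  "min_eigenvalue M = (LEAST l. \<exists>v. v \<noteq> 0 \<and> M *v v = l *\<^sub>R v)"

definition convex_extended :: "('a::real_vector \<Rightarrow> ereal) \<Rightarrow> bool" where
  "convex_extended g \<longleftrightarrow>
     (\<forall>x. g x \<noteq> -\<infinity>) \<and>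
     (\<forall>x y t. 0 \<le> t \<and> t \<le> 1 \<longrightarrow>
        g ((1 - t) *\<^sub>R x + t *\<^sub>R y) \<le> ereal (1 - t) * g x + ereal t * g y)"

definition subdifferential :: "('a::real_inner \<Rightarrow> ereal) \<Rightarrow> 'a \<Rightarrow> 'a set" where
  "subdifferential g x =
     {z. g x \<noteq> \<infinity> \<and> (\<forall>y. g x + ereal (z \<bullet> (y - x)) \<le> g y)}"

definition aug_lagrangian ::
  "(real^'d \<Rightarrow> real) \<Rightarrow> (real^'d \<Rightarrow> real^'m) \<Rightarrow> real \<Rightarrow> real^'d \<Rightarrow> real^'m \<Rightarrow> real" where
  "aug_lagrangian f A \<beta> x y = f x + A x \<bullet> y + \<beta> / 2 * (norm (A x))\<^sup>2"

definition grad_AL ::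
  "(real^'d \<Rightarrow> real) \<Rightarrow> (real^'d \<Rightarrow> real^'m) \<Rightarrow> real \<Rightarrow> real^'d \<Rightarrow> real^'m \<Rightarrow> real^'d" where
  "grad_AL f A \<beta> x y = gradient (\<lambda>z. aug_lagrangian f A \<beta> z y) x"

definition hess_AL ::
  "(real^'d \<Rightarrow> real) \<Rightarrow> (real^'d \<Rightarrow> real^'m) \<Rightarrow> real \<Rightarrow> real^'d \<Rightarrow> real^'m \<Rightarrow> real^'d^'d" where
  "hess_AL f A \<beta> x y = hessian (\<lambda>z. aug_lagrangian f A \<beta> z y) x"

(* dist(- grad_x L_beta(x,y), partial g(x)) <= e.  The distance to the closed set
   partial g(x) is a minimum, so the set has to be nonempty; infdist to the empty
   set would be 0. *)
definition stationarity_residual_le ::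
  "(real^'d \<Rightarrow> real) \<Rightarrow> (real^'d \<Rightarrow> ereal) \<Rightarrow> (real^'d \<Rightarrow> real^'m) \<Rightarrow>
   real \<Rightarrow> real^'d \<Rightarrow> real^'m \<Rightarrow> real \<Rightarrow> bool" where
  "stationarity_residual_le f g A \<beta> x y e \<longleftrightarrow>
     subdifferential g x \<noteq> {} \<and> infdist (- grad_AL f A \<beta> x y) (subdifferential g x) \<le> e"

definition first_order_stationary ::
  "(real^'d \<Rightarrow> real) \<Rightarrow> (real^'d \<Rightarrow> ereal) \<Rightarrow> (real^'d \<Rightarrow> real^'m) \<Rightarrow>
   real \<Rightarrow> real \<Rightarrow> real^'d \<Rightarrow> bool" where
  "first_order_stationary f g A \<epsilon>f \<beta> x \<longleftrightarrow>
     (\<exists>y. stationarity_residual_le f g A \<beta> x y \<epsilon>f \<and> norm (A x) \<le> \<epsilon>f)"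

(* Second-order stationarity is only considered for g = 0. *)
definition second_order_stationary ::
  "(real^'d \<Rightarrow> real) \<Rightarrow> (real^'d \<Rightarrow> real^'m) \<Rightarrow> real \<Rightarrow> real \<Rightarrow> real \<Rightarrow> real^'d \<Rightarrow> bool" where
  "second_order_stationary f A \<epsilon>f \<epsilon>s \<beta> x \<longleftrightarrow>
     (\<exists>y. stationarity_residual_le f (\<lambda>_. 0) A \<beta> x y \<epsilon>f \<and> norm (A x) \<le> \<epsilon>f \<and>
          min_eigenvalue (hess_AL f A \<beta> x y) \<ge> - \<epsilon>s)"

definition first_order_solver ::
  "(real^'d \<Rightarrow> real) \<Rightarrow> (real^'d \<Rightarrow> ereal) \<Rightarrow> (real^'d \<Rightarrow> real^'m) \<Rightarrow>
   real \<Rightarrow> real^'m \<Rightarrow> real \<Rightarrow> real^'d \<Rightarrow> bool" where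
  "first_order_solver f g A \<beta> y \<epsilon> x \<longleftrightarrow> stationarity_residual_le f g A \<beta> x y \<epsilon>"

definition second_order_solver ::
  "(real^'d \<Rightarrow> real) \<Rightarrow> (real^'d \<Rightarrow> ereal) \<Rightarrow> (real^'d \<Rightarrow> real^'m) \<Rightarrow>
   real \<Rightarrow> real^'m \<Rightarrow> real \<Rightarrow> real^'d \<Rightarrow> bool" where
  "second_order_solver f g A \<beta> y \<epsilon> x \<longleftrightarrow>
     g = (\<lambda>_. 0) \<and> stationarity_residual_le f g A \<beta> x y \<epsilon> \<and>
     min_eigenvalue (hess_AL f A \<beta> x y) \<ge> - \<epsilon>"

(* The quotient is +infinity, so that the minimum is 1, when A(x_{k+1}) = 0. *)
definition dual_step_factor ::
  "(real^'d \<Rightarrow> real^'m) \<Rightarrow> (nat \<Rightarrow> real^'d) \<Rightarrow> nat \<Rightarrow> real" where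
  "dual_step_factor A x k =
     (if A (x (k + 1)) = 0 then 1
      else min (norm (A (x 1)) * (ln 2)\<^sup>2 /
                (norm (A (x (k + 1))) * real (k + 1) * (ln (real (k + 2)))\<^sup>2)) 1)"

(* The iterates x_1, ..., x_N (all of them if N = infinity), the multipliers y_0, ..., y_N,
   the dual step sizes sigma_1, ..., sigma_N and the tolerances eps_2, ..., eps_N.
   beta 0, eps 0, eps 1, x 0, sigma 0 and everything beyond N are unconstrained, except
   that beta is an infinite sequence.  The stopping test only truncates the sequence and
   is left to the choice of N. *)
definition iALM_iterates ::
  "(real \<Rightarrow> real^'m \<Rightarrow> real \<Rightarrow> real^'d \<Rightarrow> bool) \<Rightarrow> (real^'d \<Rightarrow> real^'m) \<Rightarrow> enat \<Rightarrow>
   (nat \<Rightarrow> real) \<Rightarrow> (nat \<Rightarrow> real) \<Rightarrow> (nat \<Rightarrow> real) \<Rightarrow>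
   (nat \<Rightarrow> real^'d) \<Rightarrow> (nat \<Rightarrow> real^'m) \<Rightarrow> bool" where
  "iALM_iterates solver A N \<beta> \<epsilon> \<sigma> x y \<longleftrightarrow>
     (\<forall>k\<ge>1. \<beta> k > 0) \<and> mono_on {1..} \<beta> \<and> (\<forall>b. \<exists>k\<ge>1. \<beta> k > b) \<and>
     \<sigma> 1 > 0 \<and> y 1 = y 0 + \<sigma> 1 *\<^sub>R A (x 1) \<and>
     (\<forall>k\<ge>1. enat (k + 1) \<le> N \<longrightarrow>
        \<epsilon> (k + 1) = 1 / \<beta> k \<and>
        solver (\<beta> k) (y k) (\<epsilon> (k + 1)) (x (k + 1)) \<and>
        \<sigma> (k + 1) = \<sigma> 1 * dual_step_factor A x k \<and>
        y (k + 1) = y k + \<sigma> (k + 1) *\<^sub>R A (x (k + 1)))"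

end

theory Submission
  imports Defs
begin

text \<open>
  Write \<open>J\<close> for the Jacobian of \<open>A\<close>. Stationarity at \<open>x\<^sub>k\<close> for the penalty \<open>\<beta>\<^sub>k\<close> is witnessed not by \<open>y\<^sub>k\<close>
  but by the shifted multiplier \<open>y' = y\<^bsub>k-1\<^esub> + (\<beta>\<^bsub>k-1\<^esub> - \<beta>\<^sub>k) A(x\<^sub>k)\<close>. With it the gradients of the two
  augmented Lagrangians agree at \<open>x\<^sub>k\<close>, and the Hessians there differ by the positive semidefinite
  matrix \<open>(\<beta>\<^sub>k - \<beta>\<^bsub>k-1\<^esub>) J(x\<^sub>k)\<^sup>T J(x\<^sub>k)\<close>; so the solver's guarantees for \<open>(\<beta>\<^bsub>k-1\<^esub>, y\<^bsub>k-1\<^esub>)\<close> carry over,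
  even with tolerance \<open>\<epsilon>\<^sub>k\<close>. Feasibility comes from the regularity condition: dividing the
  stationarity inequality by \<open>\<beta>\<^bsub>k-1\<^esub>\<close> bounds the distance on its right-hand side by
  \<open>(\<lambda>'\<^sub>f + \<lambda>'\<^sub>A \<parallel>y\<^bsub>k-1\<^esub>\<parallel> + \<epsilon>\<^sub>k) / \<beta>\<^bsub>k-1\<^esub>\<close>, and the dual step sizes keep the multipliers bounded.
\<close>

section \<open>Minimal eigenvalues of symmetric matrices\<close>

text \<open>The quadratic form attains its minimum over the compact unit sphere; by homogeneity the
  minimal value bounds the form everywhere, and a minimizer is an eigenvector because the form could
  otherwise be decreased to first order.\<close>

lemma exists_min_eigenvector:
  fixes M :: "real^'n^'n"
  assumes sym: "\<And>u v. u \<bullet> (M *v v) = v \<bullet> (M *v u)"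
  obtains w m where "norm w = 1" "M *v w = m *\<^sub>R w" "\<And>v. m * (v \<bullet> v) \<le> v \<bullet> (M *v v)"
proof -
  let ?q = "\<lambda>v. v \<bullet> (M *v v)"
  have cont: "continuous_on (sphere 0 1) ?q"
    by (intro continuous_intros linear_continuous_on) auto
  obtain e :: "real^'n" where "e \<in> Basis"
    by (meson nonempty_Basis ex_in_conv)
  then have "(sphere 0 1 :: (real^'n) set) \<noteq> {}"
    by (auto intro!: exI[of _ e])
  then obtain w where w: "norm w = 1" and w_min: "\<And>v. norm v = 1 \<Longrightarrow> ?q w \<le> ?q v"
    using continuous_attains_inf[OF _ _ cont] by auto
  have le: "?q w * (v \<bullet> v) \<le> ?q v" for v
  proof (cases "v = 0")
    case False
    let ?n = "norm v"
    have "?q w \<le> ?q ((1 / ?n) *\<^sub>R v)"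
      using False by (intro w_min) simp
    also have "\<dots> = ?q v / (?n * ?n)"
      by (simp add: matrix_vector_mult_scaleR)
    finally show ?thesis
      using False by (simp add: field_simps power2_eq_square flip: power2_norm_eq_inner)
  qed simp
  \<comment> \<open>\<open>b\<close> is the eigenvector residual at \<open>w\<close>, and half the
    gradient of \<open>?q v - ?q w * (v \<bullet> v)\<close> there. If it were nonzero, moving from
    \<open>w\<close> along \<open>- b\<close> would make this nonnegative function negative.\<close>
  define b where "b = M *v w - ?q w *\<^sub>R w"
  define p where "p = b \<bullet> b"
  define q where "q = ?q b - ?q w * p"
  have "b = 0"
  proof (rule ccontr)
    assume "b \<noteq> 0"
    then have p: "p > 0" by (simp add: p_def)
    have q: "q \<ge> 0" using le[of b] by (simp add: q_def p_def)
    \<comment> \<open>This choice gives \<open>t * q = - p - t\<close>, which turns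
      \<open>2 * t * p + t^2 * q\<close> into \<open>t * (p - t)\<close>, a negative times a
      positive number. The \<open>+ 1\<close> keeps the denominator positive when
      \<open>q = 0\<close>.\<close>
    define t where "t = - p / (q + 1)"
    let ?v = "w + t *\<^sub>R b"
    have "w \<bullet> w = 1" using w by (simp add: norm_eq_1)
    have "b \<bullet> (M *v w) = p + ?q w * (b \<bullet> w)"
      by (simp add: p_def b_def algebra_simps inner_commute)
    moreover have "w \<bullet> (M *v b) = b \<bullet> (M *v w)" by (rule sym)
    ultimately have "?q ?v - ?q w * (?v \<bullet> ?v) = 2 * t * p + t\<^sup>2 * q"
      using \<open>w \<bullet> w = 1\<close>
      by (simp add: q_def p_def matrix_vector_right_distrib matrix_vector_mult_scaleR
          inner_add_left inner_add_right inner_commute power2_eq_square algebra_simps)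
    then have "0 \<le> 2 * t * p + t\<^sup>2 * q" using le[of ?v] by simp
    also have "\<dots> = t * (p - t)"
    proof -
      have "t * q = - p - t" using q by (simp add: t_def field_simps)
      then have "t * (2 * p + t * q) = t * (p - t)" by simp
      then show ?thesis by (simp add: power2_eq_square algebra_simps)
    qed
    also have "\<dots> < 0"
      using p q by (intro mult_neg_pos) (auto simp: t_def divide_neg_pos intro: less_trans)
    finally show False by simp
  qed
  then have "M *v w = ?q w *\<^sub>R w" by (simp add: b_def)
  with w le show thesis using that by blast
qed

text \<open>Replaces the \<open>LEAST\<close> over real eigenvalues by a bound on the quadratic
  form, in which adding a positive semidefinite matrix is transparent. The eigenvector just
  constructed shows that the least eigenvalue exists.\<close>

lemma min_eigenvalue_ge_iff:
  fixes M :: "real^'n^'n"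
  assumes sym: "\<And>u v. u \<bullet> (M *v v) = v \<bullet> (M *v u)"
  shows "a \<le> min_eigenvalue M \<longleftrightarrow> (\<forall>v. a * (v \<bullet> v) \<le> v \<bullet> (M *v v))"
proof -
  obtain w m where w: "norm w = 1" "M *v w = m *\<^sub>R w"
    and m: "\<And>v. m * (v \<bullet> v) \<le> v \<bullet> (M *v v)"
    using exists_min_eigenvector[OF sym] by metis
  have "min_eigenvalue M = m"
    unfolding min_eigenvalue_def
  proof (rule Least_equality)
    show "\<exists>v. v \<noteq> 0 \<and> M *v v = m *\<^sub>R v" using w by (intro exI[of _ w]) auto
    show "m \<le> l" if l: "\<exists>v. v \<noteq> 0 \<and> M *v v = l *\<^sub>R v" for l
    proof -
      from l obtain v where "v \<noteq> 0" "M *v v = l *\<^sub>R v" by blast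
      then show ?thesis using m[of v] by simp
    qed
  qed
  moreover have "w \<bullet> w = 1" using w by (simp add: norm_eq_1)
  ultimately show ?thesis
    using m w(2) by (auto intro: order_trans[OF mult_right_mono] dest: spec[of _ w])
qed

section \<open>Symmetry of second derivatives\<close>

text \<open>The mean value theorem in direction \<open>u\<close> reduces the second difference of
  \<open>h\<close> to a first difference of \<open>G\<close>, and differentiability of
  \<open>G\<close> at the single point \<open>x\<close> then controls the error. Continuity of the
  second derivative is not assumed.\<close>

lemma second_difference_approx:
  fixes h :: "'a::real_inner \<Rightarrow> real"
  assumes h: "\<And>z. (h has_derivative (\<lambda>v. v \<bullet> G z)) (at z)"
    and G: "(G has_derivative H) (at x)"
    and e: "e > 0"
  shows "\<exists>d>0. \<forall>t. 0 < t \<and> t < d \<longrightarrow>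
    \<bar>h (x + t *\<^sub>R u + t *\<^sub>R v) - h (x + t *\<^sub>R u) - h (x + t *\<^sub>R v) + h x - t\<^sup>2 * (u \<bullet> H v)\<bar> \<le> e * t\<^sup>2"
proof -
  interpret H: bounded_linear H using G by (rule has_derivative_bounded_linear)
  \<comment> \<open>Two remainders of size \<open>e / c * (t * n)\<close>, paired with
    \<open>t *\<^sub>R u\<close>, give \<open>e * t^2 * ((c - 1) / c)\<close> in total; the
    \<open>+ 1\<close> keeps \<open>c\<close> positive.\<close>
  define c where "c = 2 * norm u * (norm u + norm v) + 1"
  have c: "c > 0" by (simp add: c_def add_nonneg_pos)
  obtain d0 where d0: "d0 > 0"
    and approx: "\<And>w. norm (w - x) < d0 \<Longrightarrow> norm (G w - G x - H (w - x)) \<le> e / c * norm (w - x)"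
    using G e c unfolding has_derivative_at_alt by (metis divide_pos_pos)
  define n where "n = norm u + norm v"
  define d where "d = d0 / (n + 1)"
  have n: "n \<ge> 0" by (simp add: n_def)
  have "\<bar>h (x + t *\<^sub>R u + t *\<^sub>R v) - h (x + t *\<^sub>R u) - h (x + t *\<^sub>R v) + h x - t\<^sup>2 * (u \<bullet> H v)\<bar> \<le> e * t\<^sup>2"
    if t: "0 < t" "t < d" for t
  proof -
    define \<phi> where "\<phi> s = h (x + s *\<^sub>R (t *\<^sub>R u) + t *\<^sub>R v) - h (x + s *\<^sub>R (t *\<^sub>R u))" for s
    have "(\<phi> has_real_derivative
        t * (u \<bullet> (G (x + s *\<^sub>R (t *\<^sub>R u) + t *\<^sub>R v) - G (x + s *\<^sub>R (t *\<^sub>R u))))) (at s)" for s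
    proof -
      have "((\<lambda>s. h (x + s *\<^sub>R (t *\<^sub>R u) + a)) has_derivative
          (\<lambda>r. r *\<^sub>R (t *\<^sub>R u) \<bullet> G (x + s *\<^sub>R (t *\<^sub>R u) + a))) (at s)" for a
        by (rule has_derivative_compose[OF _ h]) (auto intro!: derivative_eq_intros)
      from has_derivative_diff[OF this[of "t *\<^sub>R v"] this[of 0]] show ?thesis
        unfolding has_field_derivative_def \<phi>_def[abs_def] add_0_right
        by (rule has_derivative_eq_rhs) (simp add: fun_eq_iff inner_diff_right algebra_simps)
    qed
    from MVT2[OF zero_less_one this] obtain s where s: "0 < s" "s < 1"
      and mvt: "\<phi> 1 - \<phi> 0 = t * (u \<bullet> (G (x + s *\<^sub>R (t *\<^sub>R u) + t *\<^sub>R v) - G (x + s *\<^sub>R (t *\<^sub>R u))))"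
      by auto
    define R where "R w = G w - G x - H (w - x)" for w
    \<comment> \<open>Both points lie within \<open>t * n < d0\<close> of \<open>x\<close>, so
      \<open>G\<close> can be linearized at \<open>x\<close> for each; the linear parts differ by
      exactly \<open>t *\<^sub>R H v\<close>.\<close>
    define p q where "p = x + s *\<^sub>R (t *\<^sub>R u) + t *\<^sub>R v" and "q = x + s *\<^sub>R (t *\<^sub>R u)"
    have "\<phi> 1 - \<phi> 0 = t * (u \<bullet> (G p - G q))"
      using mvt by (simp only: p_def q_def)
    moreover have "G p - G q = t *\<^sub>R H v + (R p - R q)"
      by (simp add: R_def p_def q_def H.add H.scaleR algebra_simps)
    ultimately have eq: "\<phi> 1 - \<phi> 0 - t\<^sup>2 * (u \<bullet> H v) = t * (u \<bullet> (R p - R q))"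
      by (simp add: inner_add_right power2_eq_square distrib_left)
    have "t * n < d0"
    proof -
      have "t * n \<le> t * (n + 1)" using t by simp
      also have "\<dots> < d0" using t n by (simp add: d_def field_simps)
      finally show ?thesis .
    qed
    moreover have su: "norm (s *\<^sub>R (t *\<^sub>R u)) \<le> t * norm u"
      using s t by (simp add: mult_left_le_one_le)
    then have "norm (p - x) \<le> t * n" "norm (q - x) \<le> t * n"
      using t norm_triangle_ineq[of "s *\<^sub>R (t *\<^sub>R u)" "t *\<^sub>R v"]
      by (auto simp: p_def q_def n_def distrib_left intro: order_trans)
    ultimately have "norm (R p) \<le> e / c * (t * n)" "norm (R q) \<le> e / c * (t * n)"
      using approx[of p] approx[of q] e c unfolding R_def
      by (meson divide_pos_pos less_imp_le mult_left_mono order_le_less_trans order_trans)+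
    then have R_le: "norm (R p - R q) \<le> 2 * (e / c * (t * n))"
      unfolding mult_2 by (rule order_trans[OF norm_triangle_ineq4 add_mono])
    have "\<bar>u \<bullet> (R p - R q)\<bar> \<le> norm u * (2 * (e / c * (t * n)))"
      by (rule order_trans[OF Cauchy_Schwarz_ineq2 mult_left_mono[OF R_le]]) simp
    then have "t * \<bar>u \<bullet> (R p - R q)\<bar> \<le> t * (norm u * (2 * (e / c * (t * n))))"
      using t by (intro mult_left_mono) simp_all
    then have "\<bar>\<phi> 1 - \<phi> 0 - t\<^sup>2 * (u \<bullet> H v)\<bar> \<le> t * (norm u * (2 * (e / c * (t * n))))"
      unfolding eq abs_mult using t by simp
    also have "\<dots> = e * t\<^sup>2 * ((c - 1) / c)"
      by (simp add: c_def n_def power2_eq_square)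
    also have "\<dots> \<le> e * t\<^sup>2"
      using c e by (intro mult_left_le) (auto simp: field_simps)
    finally show ?thesis by (simp add: \<phi>_def algebra_simps)
  qed
  moreover have "d > 0" using d0 n by (simp add: d_def)
  ultimately show ?thesis by blast
qed

text \<open>The second difference is unchanged when \<open>u\<close> and \<open>v\<close> are
  swapped, so for small \<open>t\<close> both bilinear values, scaled by \<open>t^2\<close>, are
  within \<open>e / 2 * t^2\<close> of the same number.\<close>

lemma second_derivative_symmetric:
  fixes h :: "'a::real_inner \<Rightarrow> real"
  assumes h: "\<And>z. (h has_derivative (\<lambda>v. v \<bullet> G z)) (at z)"
    and G: "(G has_derivative H) (at x)"
  shows "u \<bullet> H v = v \<bullet> H u"
proof -
  have bound: "\<bar>u \<bullet> H v - v \<bullet> H u\<bar> \<le> e" if e: "e > 0" for e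
  proof -
    have "e / 2 > 0" using e by simp
    note approx = second_difference_approx[OF h G this]
    let ?D = "\<lambda>t u v. h (x + t *\<^sub>R u + t *\<^sub>R v) - h (x + t *\<^sub>R u) - h (x + t *\<^sub>R v) + h x"
    obtain d where d: "d > 0"
      "\<And>t. 0 < t \<Longrightarrow> t < d \<Longrightarrow> \<bar>?D t u v - t\<^sup>2 * (u \<bullet> H v)\<bar> \<le> e / 2 * t\<^sup>2"
      using approx[of u v] by blast
    obtain d' where d': "d' > 0"
      "\<And>t. 0 < t \<Longrightarrow> t < d' \<Longrightarrow> \<bar>?D t v u - t\<^sup>2 * (v \<bullet> H u)\<bar> \<le> e / 2 * t\<^sup>2"
      using approx[of v u] by blast
    define t where "t = min d d' / 2"
    have t: "0 < t" "t < d" "t < d'" using d(1) d'(1) by (auto simp: t_def)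
    have "?D t v u = ?D t u v" by (simp add: algebra_simps)
    then have "\<bar>t\<^sup>2 * (u \<bullet> H v) - t\<^sup>2 * (v \<bullet> H u)\<bar> \<le> e * t\<^sup>2"
      using d(2)[of t] d'(2)[of t] t by argo
    then have "t\<^sup>2 * \<bar>u \<bullet> H v - v \<bullet> H u\<bar> \<le> t\<^sup>2 * e"
      unfolding right_diff_distrib[symmetric] abs_mult by (simp add: mult.commute)
    then show ?thesis using t by simp
  qed
  have "\<bar>u \<bullet> H v - v \<bullet> H u\<bar> \<le> 0"
    by (rule field_le_epsilon) (simp add: bound)
  then show ?thesis by simp
qed

section \<open>Gradients and the spectral norm\<close>

lemma gradient_eqI: "GDERIV h x :> D \<Longrightarrow> gradient h x = D"
  unfolding gradient_def
proof (rule the_equality)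
  fix D' assume "GDERIV h x :> D" "GDERIV h x :> D'"
  then have "(\<lambda>v. v \<bullet> D) = (\<lambda>v. v \<bullet> D')"
    unfolding gderiv_def by (rule has_derivative_unique)
  then show "D' = D" by (metis vector_eq_ldot)
qed

text \<open>Riesz representation in coordinates: the derivative \<open>h'\<close> is the inner
  product with the vector whose coordinates are the values \<open>h' b\<close>.\<close>

lemma GDERIV_gradient:
  assumes "h differentiable (at x)"
  shows "GDERIV h x :> gradient h x"
proof -
  obtain h' where h': "(h has_derivative h') (at x)"
    using assms by (auto simp: differentiable_def)
  then interpret h': linear h' by (rule has_derivative_linear)
  have "h' v = v \<bullet> (\<Sum>b\<in>Basis. h' b *\<^sub>R b)" for v
    by (subst (1) euclidean_representation[of v, symmetric])
       (simp add: h'.sum h'.scale inner_sum_right mult.commute)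
  then have "h' = (\<lambda>v. v \<bullet> (\<Sum>b\<in>Basis. h' b *\<^sub>R b))" by blast
  then have "GDERIV h x :> (\<Sum>b\<in>Basis. h' b *\<^sub>R b)"
    using h' unfolding gderiv_def by metis
  then show ?thesis using gradient_eqI by metis
qed

lemma spectral_norm_mult_le: "norm (M *v u) \<le> spectral_norm M * norm u"
  unfolding spectral_norm_def by (rule onorm) simp

lemma spectral_norm_nonneg: "0 \<le> spectral_norm M"
  unfolding spectral_norm_def by (rule onorm_pos_le) simp

text \<open>With \<open>u = w v* M\<close>, the square of \<open>norm u\<close> equals
  \<open>w \<bullet> (M *v u)\<close>, which is at most
  \<open>norm w * spectral_norm M * norm u\<close>; one factor \<open>norm u\<close>
  cancels.\<close>

lemma spectral_norm_transpose_mult_le: "norm (w v* M) \<le> spectral_norm M * norm w"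
proof (cases "w v* M = 0")
  case False
  have "norm (w v* M) * norm (w v* M) = w \<bullet> (M *v (w v* M))"
    by (metis dot_lmul_matrix power2_eq_square power2_norm_eq_inner)
  also have "\<dots> \<le> norm w * (spectral_norm M * norm (w v* M))"
    by (rule order_trans[OF norm_cauchy_schwarz mult_left_mono[OF spectral_norm_mult_le]]) simp
  finally show ?thesis using False by (simp add: mult.commute mult.left_commute)
qed (simp add: spectral_norm_nonneg)

lemma spectral_norm_triangle: "spectral_norm M \<le> spectral_norm N + spectral_norm (M - N)"
proof -
  have "onorm (\<lambda>v. N *v v + (M - N) *v v) \<le> onorm ((*v) N) + onorm ((*v) (M - N))"
    by (rule onorm_triangle) simp_all
  then show ?thesis by (simp add: spectral_norm_def matrix_vector_mult_diff_rdistrib)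
qed

section \<open>The augmented Lagrangian\<close>

lemma GDERIV_aug_lagrangian:
  assumes "f differentiable (at z)" "A differentiable (at z)"
  shows "GDERIV (\<lambda>w. aug_lagrangian f A b w u) z :>
    gradient f z + (u + b *\<^sub>R A z) v* jacobian A (at z)"
proof -
  have "(f has_derivative (\<lambda>v. v \<bullet> gradient f z)) (at z)"
    using GDERIV_gradient[OF assms(1)] by (simp only: gderiv_def)
  moreover have A: "(A has_derivative (\<lambda>v. jacobian A (at z) *v v)) (at z)"
    using assms(2) by (simp add: jacobian_works)
  have "((\<lambda>w. A w \<bullet> u) has_derivative (\<lambda>v. (jacobian A (at z) *v v) \<bullet> u)) (at z)"
    by (rule has_derivative_inner_left[OF A])
  moreover have "((\<lambda>w. b / 2 * (A w \<bullet> A w)) has_derivative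
      (\<lambda>v. b / 2 * (A z \<bullet> (jacobian A (at z) *v v) + (jacobian A (at z) *v v) \<bullet> A z))) (at z)"
    by (rule has_derivative_mult_right[OF has_derivative_inner[OF A A]])
  ultimately have "((\<lambda>w. f w + A w \<bullet> u + b / 2 * (A w \<bullet> A w)) has_derivative
      (\<lambda>v. v \<bullet> gradient f z + (jacobian A (at z) *v v) \<bullet> u
        + b / 2 * (A z \<bullet> (jacobian A (at z) *v v) + (jacobian A (at z) *v v) \<bullet> A z))) (at z)"
    by (intro has_derivative_add)
  then show ?thesis
    unfolding aug_lagrangian_def gderiv_def power2_norm_eq_inner
    by (rule has_derivative_eq_rhs)
       (simp add: fun_eq_iff inner_add_right inner_commute[of _ "_ v* _"] dot_lmul_matrix
         inner_add_left inner_commute[of "A z"] inner_commute[of u])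
qed

text \<open>Multiplier and penalty enter only through \<open>u + b *\<^sub>R A z\<close>; this is
  what allows a change of \<open>b\<close> to be compensated by a shift of \<open>u\<close> at a
  fixed point.\<close>

lemma grad_AL_eq:
  assumes "f differentiable (at z)" "A differentiable (at z)"
  shows "grad_AL f A b z u = gradient f z + (u + b *\<^sub>R A z) v* jacobian A (at z)"
  unfolding grad_AL_def using GDERIV_aug_lagrangian[OF assms] by (rule gradient_eqI)

lemma hess_AL_has_derivative:
  assumes "(\<lambda>w. grad_AL f A b w u) differentiable (at z)"
  shows "((\<lambda>w. grad_AL f A b w u) has_derivative ((*v) (hess_AL f A b z u))) (at z)"
  using assms by (simp add: jacobian_works hess_AL_def hessian_def grad_AL_def[abs_def])

lemma hess_AL_symmetric:
  assumes "\<And>z. f differentiable (at z)" "\<And>z. A differentiable (at z)"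
    and "(\<lambda>w. grad_AL f A b w u) differentiable (at z)"
  shows "p \<bullet> (hess_AL f A b z u *v q) = q \<bullet> (hess_AL f A b z u *v p)"
  using GDERIV_aug_lagrangian[OF assms(1,2)] hess_AL_has_derivative[OF assms(3)]
  by (intro second_derivative_symmetric[of "\<lambda>w. aug_lagrangian f A b w u"])
     (simp_all add: gderiv_def grad_AL_eq[OF assms(1,2)])

text \<open>No product rule here: \<open>J\<close> is only Lipschitz, but it is multiplied by a factor vanishing at \<open>z\<close>.\<close>

lemma has_derivative_transpose_jacobian_mult:
  fixes A :: "real^'d \<Rightarrow> real^'m"
  assumes A: "A differentiable (at z)"
    and Lip: "\<And>w. spectral_norm (jacobian A (at w) - jacobian A (at z)) \<le> L * norm (w - z)"
  shows "((\<lambda>w. (A w - A z) v* jacobian A (at w)) has_derivative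
    (\<lambda>v. (jacobian A (at z) *v v) v* jacobian A (at z))) (at z)"
proof -
  let ?J = "\<lambda>w. jacobian A (at w)"
  have DA: "(A has_derivative (\<lambda>v. ?J z *v v)) (at z)" using A by (simp add: jacobian_works)
  have lin: "bounded_linear (\<lambda>v. v v* ?J z)"
    using matrix_vector_mul_bounded_linear[of "transpose (?J z)"]
    unfolding transpose_matrix_vector[abs_def] .
  have "((\<lambda>w. (A w - A z) v* ?J z) has_derivative (\<lambda>v. (?J z *v v) v* ?J z)) (at z)"
    by (rule bounded_linear.has_derivative[OF lin]) (auto intro!: derivative_eq_intros DA)
  \<comment> \<open>The Lipschitz bound on \<open>?J\<close> absorbs the denominator
    \<open>norm (w - z)\<close> of the difference quotient; the remaining factor
    \<open>norm (A w - A z)\<close> tends to 0 by continuity.\<close>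
  moreover have "((\<lambda>w. (A w - A z) v* (?J w - ?J z)) has_derivative (\<lambda>_. 0)) (at z)"
  proof (rule has_derivativeI_sandwich[of 1])
    show "norm (((A w - A z) v* (?J w - ?J z) - (A z - A z) v* (?J z - ?J z)) - 0) / norm (w - z)
        \<le> L * norm (A w - A z)" if "w \<noteq> z" for w
    proof -
      have "norm ((A w - A z) v* (?J w - ?J z)) \<le> L * norm (w - z) * norm (A w - A z)"
        by (rule order_trans[OF spectral_norm_transpose_mult_le mult_right_mono[OF Lip]]) simp
      then show ?thesis using that by (simp add: field_simps)
    qed
    have "isCont A z" using DA by (rule has_derivative_continuous)
    then have "((\<lambda>w. L * norm (A w - A z)) \<longlongrightarrow> L * norm (A z - A z)) (at z)"
      unfolding isCont_def by (intro tendsto_intros)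
    then show "((\<lambda>w. L * norm (A w - A z)) \<longlongrightarrow> 0) (at z)" by simp
  qed simp_all
  ultimately have "((\<lambda>w. (A w - A z) v* ?J z + (A w - A z) v* (?J w - ?J z)) has_derivative
      (\<lambda>v. (?J z *v v) v* ?J z + 0)) (at z)"
    by (rule has_derivative_add)
  moreover have "v v* ?J z + v v* (?J w - ?J z) = v v* ?J w" for v w
    by (simp add: vec_eq_iff vector_matrix_mult_def sum.distrib[symmetric] algebra_simps)
  ultimately show ?thesis by simp
qed

text \<open>With the multiplier shift frozen at \<open>z\<close>, the two gradients differ as
  functions of \<open>w\<close> by \<open>(b' - b) *\<^sub>R ((A w - A z) v* J w)\<close>. Its
  derivative at \<open>z\<close> contributes \<open>(b' - b) * (norm (J z *v v))^2\<close> to the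
  quadratic form, which is nonnegative. Symmetry of both Hessians turns this into a comparison of
  eigenvalues.\<close>

lemma min_eigenvalue_hess_AL_shift:
  fixes A :: "real^'d \<Rightarrow> real^'m"
  assumes f: "\<And>z. f differentiable (at z)" and A: "\<And>z. A differentiable (at z)"
    and Lip: "\<And>w. spectral_norm (jacobian A (at w) - jacobian A (at z)) \<le> L * norm (w - z)"
    and diff: "(\<lambda>w. grad_AL f A b w u) differentiable (at z)"
      "(\<lambda>w. grad_AL f A b' w (u + (b - b') *\<^sub>R A z)) differentiable (at z)"
    and "b \<le> b'"
    and a: "a \<le> min_eigenvalue (hess_AL f A b z u)"
  shows "a \<le> min_eigenvalue (hess_AL f A b' z (u + (b - b') *\<^sub>R A z))"
proof -
  let ?J = "\<lambda>w. jacobian A (at w)"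
  let ?H = "hess_AL f A b z u" and ?H' = "hess_AL f A b' z (u + (b - b') *\<^sub>R A z)"
  have "grad_AL f A b' w (u + (b - b') *\<^sub>R A z) =
      grad_AL f A b w u + (b' - b) *\<^sub>R ((A w - A z) v* ?J w)" for w
    by (simp add: grad_AL_eq f A vec_eq_iff vector_matrix_mult_def sum_distrib_left
        sum.distrib[symmetric] algebra_simps)
  then have "((\<lambda>w. grad_AL f A b' w (u + (b - b') *\<^sub>R A z)) has_derivative
      (\<lambda>v. ?H *v v + (b' - b) *\<^sub>R ((?J z *v v) v* ?J z))) (at z)"
    using has_derivative_add[OF hess_AL_has_derivative[OF diff(1)]
        has_derivative_scaleR_right[OF has_derivative_transpose_jacobian_mult[OF A Lip]]]
    by simp
  from has_derivative_unique[OF hess_AL_has_derivative[OF diff(2)] this]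
  have "?H' *v v = ?H *v v + (b' - b) *\<^sub>R ((?J z *v v) v* ?J z)" for v
    by meson
  then have "v \<bullet> (?H' *v v) = v \<bullet> (?H *v v) + (b' - b) * (norm (?J z *v v))\<^sup>2" for v
    by (simp add: inner_add_right inner_commute[of v "_ v* _"] dot_lmul_matrix power2_norm_eq_inner)
  then have "v \<bullet> (?H *v v) \<le> v \<bullet> (?H' *v v)" for v
    using \<open>b \<le> b'\<close> by simp
  then show ?thesis
    using a hess_AL_symmetric[OF f A diff(1)] hess_AL_symmetric[OF f A diff(2)]
    by (simp add: min_eigenvalue_ge_iff) (meson order_trans)
qed

section \<open>Boundedness of the multipliers\<close>

text \<open>Comparison with the telescoping series of \<open>2 / ln (n + 2)\<close>. The index shift
  by 2 makes all logarithms in the comparison positive, and the factor 2 comes from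
  \<open>1 / (n + 2) \<le> 2 / (n + 3)\<close>.\<close>

lemma summable_inverse_nat_ln_square:
  "summable (\<lambda>i. 1 / (real i * (ln (real (i + 1)))\<^sup>2))"
proof -
  let ?f = "\<lambda>n. 2 / ln (real (n + 2))"
  have "?f \<longlonglongrightarrow> 0" 
    by (intro tendsto_divide_0[OF tendsto_const] filterlim_at_top_imp_at_infinity
        filterlim_compose[OF ln_at_top] filterlim_compose[OF filterlim_real_sequentially]
        filterlim_add_const_nat_at_top)
  then have "summable (\<lambda>n. ?f n - ?f (Suc n))" by (rule telescope_summable')
  then have "summable (\<lambda>n. 1 / (real (n + 2) * (ln (real (n + 2 + 1)))\<^sup>2))"
  proof (rule summable_comparison_test'[where N = 0])
    fix n :: nat
    define a b where "a = ln (real (n + 2))" and "b = ln (real (n + 3))"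
    have a: "a > 0" "a \<le> b" by (simp_all add: a_def b_def)
    have "a - b = ln (real (n + 2) / real (n + 3))" by (simp add: a_def b_def ln_div)
    also have "\<dots> \<le> real (n + 2) / real (n + 3) - 1" by (intro ln_le_minus_one) simp
    also have "\<dots> = - 1 / real (n + 3)" by (simp add: field_simps)
    finally have gap: "1 / real (n + 3) \<le> b - a" by simp
    have "1 / (real (n + 2) * b\<^sup>2) = 1 / real (n + 2) / b\<^sup>2" by simp
    also have "\<dots> \<le> 2 * (1 / real (n + 3)) / b\<^sup>2"
      by (intro divide_right_mono) (simp_all add: field_simps)
    also have "\<dots> \<le> 2 * (b - a) / b\<^sup>2"
      using gap by (intro divide_right_mono mult_left_mono) simp_all
    also have "\<dots> \<le> 2 * (b - a) / (a * b)"
      using a by (intro divide_left_mono) (simp_all add: power2_eq_square)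
    also have "\<dots> = 2 / a - 2 / b" using a by (simp add: field_simps)
    finally have "1 / (real (n + 2) * b\<^sup>2) \<le> 2 / a - 2 / b" .
    moreover have "n + 2 + 1 = n + 3" "Suc n + 2 = n + 3" by simp_all
    ultimately show "norm (1 / (real (n + 2) * (ln (real (n + 2 + 1)))\<^sup>2)) \<le> ?f n - ?f (Suc n)"
      unfolding a_def b_def by (simp only: real_norm_def) simp
  qed
  then show ?thesis by (rule summable_iff_shift[THEN iffD1])
qed

text \<open>Summability is essential here: an \<open>infsum\<close> that does not converge would be
  0 by default.\<close>

lemma sum_inverse_nat_ln_square_le_infsum:
  "(\<Sum>i=1..n. 1 / (real i * (ln (real (i + 1)))\<^sup>2))
    \<le> (\<Sum>\<^sub>\<infinity>i\<in>{1..}. 1 / (real i * (ln (real (i + 1)))\<^sup>2))"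
proof (rule finite_sum_le_infsum)
  show "(\<lambda>i. 1 / (real i * (ln (real (i + 1)))\<^sup>2)) summable_on {1..}"
    by (rule summable_on_subset[OF _ subset_UNIV])
       (simp add: summable_on_UNIV_nonneg_real_iff summable_inverse_nat_ln_square[simplified])
qed auto

lemma dual_step_factor_nonneg: "0 \<le> dual_step_factor A x k"
  by (simp add: dual_step_factor_def)

text \<open>The step size is built so that \<open>norm (A (x (k + 1)))\<close> cancels, leaving a
  summable bound that depends on the iterates only through \<open>x 1\<close>. If that norm is 0,
  the left side vanishes whatever the factor is.\<close>

lemma dual_step_factor_mult_le:
  "dual_step_factor A x k * norm (A (x (k + 1)))
    \<le> norm (A (x 1)) * (ln 2)\<^sup>2 / (real (k + 1) * (ln (real (k + 2)))\<^sup>2)"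
proof (cases "A (x (k + 1)) = 0")
  case False
  let ?a = "norm (A (x (k + 1)))" and ?b = "real (k + 1) * (ln (real (k + 2)))\<^sup>2"
  have "dual_step_factor A x k \<le> norm (A (x 1)) * (ln 2)\<^sup>2 / (?a * ?b)"
    using False by (simp add: dual_step_factor_def mult.assoc)
  then have "dual_step_factor A x k * ?a \<le> norm (A (x 1)) * (ln 2)\<^sup>2 / (?a * ?b) * ?a"
    by (rule mult_right_mono) simp
  also have "\<dots> = norm (A (x 1)) * (ln 2)\<^sup>2 / ?b" using False by simp
  finally show ?thesis .
qed simp

lemma iALM_multiplier_bound:
  assumes iter: "iALM_iterates solver A N \<beta> \<epsilon> \<sigma> x y"
    and k: "1 \<le> k" "enat k \<le> N"
  shows "norm (y k) \<le> norm (y 0)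
    + \<sigma> 1 * (ln 2)\<^sup>2 * norm (A (x 1)) * (\<Sum>i=1..k. 1 / (real i * (ln (real (i + 1)))\<^sup>2))"
  using k
proof (induction k rule: nat_induct_at_least)
  \<comment> \<open>The summand for \<open>i = 1\<close> is \<open>1 / (ln 2)^2\<close>, which
    cancels the prefactor and matches the full first step \<open>\<sigma> 1\<close>.\<close>
  case base
  have "norm (y 1) \<le> norm (y 0) + \<sigma> 1 * norm (A (x 1))"
    using iter norm_triangle_ineq[of "y 0" "\<sigma> 1 *\<^sub>R A (x 1)"] by (simp add: iALM_iterates_def)
  then show ?case by simp
next
  case (Suc k)
  have le: "enat k \<le> N" using Suc.prems by (meson enat_ord_simps(1) le_SucI order_refl order_trans)
  have \<sigma>: "\<sigma> 1 > 0" "\<sigma> (k + 1) = \<sigma> 1 * dual_step_factor A x k"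
    and y: "y (k + 1) = y k + \<sigma> (k + 1) *\<^sub>R A (x (k + 1))"
    using iter Suc by (auto simp: iALM_iterates_def)
  have "norm (y (k + 1)) \<le> norm (y k) + \<sigma> 1 * (dual_step_factor A x k * norm (A (x (k + 1))))"
    unfolding y using norm_triangle_ineq[of "y k" "\<sigma> (k + 1) *\<^sub>R A (x (k + 1))"] \<sigma>
    by (simp add: abs_mult dual_step_factor_nonneg mult.assoc)
  also have "\<dots> \<le> norm (y k)
      + \<sigma> 1 * (norm (A (x 1)) * (ln 2)\<^sup>2 / (real (k + 1) * (ln (real (k + 2)))\<^sup>2))"
    using \<sigma>(1) by (intro add_left_mono mult_left_mono dual_step_factor_mult_le) simp
  finally show ?case using Suc.IH[OF le] by (simp add: distrib_left mult_ac)
qed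

section \<open>Stationarity of the iterates\<close>

text \<open>Scaling by \<open>b\<close> turns the distance from \<open>u\<close> to
  \<open>S / b\<close> into that from \<open>b *\<^sub>R u\<close> to \<open>S\<close>, and the
  triangle inequality moves the base point to \<open>v\<close>. It links the regularity condition to
  the solver's residual.\<close>

lemma infdist_le_scaled_infdist:
  fixes u v :: "'a::real_normed_vector"
  assumes "b > 0" "S \<noteq> {}"
  shows "infdist u ((\<lambda>z. (1 / b) *\<^sub>R z) ` S) \<le> (norm (b *\<^sub>R u - v) + infdist v S) / b"
proof -
  have "b * infdist u ((\<lambda>z. (1 / b) *\<^sub>R z) ` S) \<le> infdist (b *\<^sub>R u) S"
    unfolding infdist_notempty[OF assms(2)]
  proof (rule cINF_greatest[OF assms(2)])
    fix s assume "s \<in> S"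
    then have "infdist u ((\<lambda>z. (1 / b) *\<^sub>R z) ` S) \<le> dist u ((1 / b) *\<^sub>R s)"
      by (intro infdist_le) auto
    then have "b * infdist u ((\<lambda>z. (1 / b) *\<^sub>R z) ` S) \<le> b * dist u ((1 / b) *\<^sub>R s)"
      using assms by simp
    also have "\<dots> = norm (b *\<^sub>R (u - (1 / b) *\<^sub>R s))"
      using assms by (simp add: dist_norm)
    also have "\<dots> = dist (b *\<^sub>R u) s"
      using assms by (simp add: dist_norm algebra_simps)
    finally show "b * infdist u ((\<lambda>z. (1 / b) *\<^sub>R z) ` S) \<le> dist (b *\<^sub>R u) s" .
  qed
  also have "\<dots> \<le> infdist v S + dist (b *\<^sub>R u) v"
    by (rule infdist_triangle)
  finally show ?thesis
    using assms by (simp add: dist_norm field_simps)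
qed

lemma feasibility_from_regularity:
  fixes A :: "real^'d \<Rightarrow> real^'m"
  assumes diff: "f differentiable (at z)" "A differentiable (at z)"
    and b: "b > 0"
    and res: "stationarity_residual_le f g A b z u e"
    and reg: "\<nu> * norm (A z) \<le> infdist (- (transpose (jacobian A (at z)) *v A z))
      ((\<lambda>s. (1 / b) *\<^sub>R s) ` subdifferential g z)"
  shows "\<nu> * norm (A z) \<le>
    (norm (gradient f z) + spectral_norm (jacobian A (at z)) * norm u + e) / b"
proof -
  let ?J = "jacobian A (at z)"
  \<comment> \<open>The penalty term cancels, so what remains is bounded independently of
    \<open>b\<close>.\<close>
  have "b *\<^sub>R (- (A z v* ?J)) - (- grad_AL f A b z u) = gradient f z + u v* ?J"
    by (simp add: grad_AL_eq[OF diff] vec_eq_iff vector_matrix_mult_def sum_distrib_left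
        sum.distrib[symmetric] sum_negf[symmetric] algebra_simps)
  then have "norm (b *\<^sub>R (- (A z v* ?J)) - (- grad_AL f A b z u))
      \<le> norm (gradient f z) + spectral_norm ?J * norm u"
    using norm_triangle_ineq[of "gradient f z" "u v* ?J"] spectral_norm_transpose_mult_le[of u ?J]
    by simp
  moreover have "infdist (- grad_AL f A b z u) (subdifferential g z) \<le> e"
    and "subdifferential g z \<noteq> {}"
    using res by (auto simp: stationarity_residual_le_def)
  ultimately show ?thesis
    using reg infdist_le_scaled_infdist[OF b, of "subdifferential g z" "- (A z v* ?J)" "- grad_AL f A b z u"] b
    by simp (smt (verit) divide_right_mono)
qed

lemma stationarity_residual_shift:
  assumes "f differentiable (at z)" "A differentiable (at z)"
  shows "stationarity_residual_le f g A b' z (u + (b - b') *\<^sub>R A z) e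
    \<longleftrightarrow> stationarity_residual_le f g A b z u e"
  by (simp add: stationarity_residual_le_def grad_AL_eq assms algebra_simps)

theorem theorem4p1:
  fixes f :: "real^'d \<Rightarrow> real" and A :: "real^'d \<Rightarrow> real^'m" and g :: "real^'d \<Rightarrow> ereal"
    and k0 :: nat and k1 :: enat and K :: "nat set"
    and \<beta> \<epsilon> \<sigma> :: "nat \<Rightarrow> real" and x :: "nat \<Rightarrow> real^'d" and y :: "nat \<Rightarrow> real^'m"
    and \<rho> lf lA lf' lA' \<nu> c S ymax :: real and \<epsilon>f \<epsilon>s :: "nat \<Rightarrow> real"
  assumes f_C1: "\<And>z. f differentiable (at z)" "continuous_on UNIV (gradient f)"
    and A_diff: "\<And>z. A differentiable (at z)"
    and g_convex: "convex_extended g"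
    and K_bounds: "2 \<le> k0" "enat k0 \<le> k1"
    and K_def: "K = {k. k0 \<le> k \<and> enat k \<le> k1}"
    and rho_finite: "bdd_above ((\<lambda>k. norm (x k)) ` K)"
    and rho_def: "\<rho> = (SUP k\<in>K. norm (x k))"
    and Lipschitz_nonneg: "0 \<le> lf" "0 \<le> lA"
    and Lipschitz_f: "\<And>z z'. norm (gradient f z - gradient f z') \<le> lf * norm (z - z')"
    and Lipschitz_A: "\<And>z z'. spectral_norm (jacobian A (at z) - jacobian A (at z')) \<le> lA * norm (z - z')"
    and lf'_eq: "lf' = (SUP z\<in>cball 0 \<rho>. norm (gradient f z))"
    and lA'_eq: "lA' = (SUP z\<in>cball 0 \<rho>. spectral_norm (jacobian A (at z)))"
    and nu_pos: "\<nu> > 0"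
    and regularity: "\<And>k. k \<in> K \<Longrightarrow>
      \<nu> * norm (A (x k)) \<le>
        infdist (- (transpose (jacobian A (at (x k))) *v A (x k)))
                ((\<lambda>z. (1 / \<beta> (k - 1)) *\<^sub>R z) ` subdifferential g (x k))"
    and S_def: "S = (\<Sum>\<^sub>\<infinity>i\<in>{1..}. 1 / (real i * (ln (real (i + 1)))\<^sup>2))"
    and c_ge: "c \<ge> S"
    and c_dual_step: "c \<ge> \<sigma> 1 * (ln 2)\<^sup>2 * S"
    and ymax_def: "ymax = norm (y 0) + c * norm (A (x 1))"
    and k0_large: "1 / \<beta> (k0 - 1) \<le> lf' + lA' * ymax + \<nu>"
    and ef_def: "\<And>k. \<epsilon>f k = 1 / \<beta> (k - 1) *
      (2 * (lf' + lA' * ymax) * (1 + lA' * \<sigma> k) / \<nu> + 1)"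
    and es_def: "\<And>k. \<epsilon>s k = \<epsilon> k + \<sigma> k * sqrt (real CARD('m)) * lA *
      ((2 * lf' + 2 * lA' * ymax) / (\<nu> * \<beta> (k - 1)))"
  shows "(iALM_iterates (first_order_solver f g A) A k1 \<beta> \<epsilon> \<sigma> x y \<longrightarrow>
           (\<forall>k\<in>K. first_order_stationary f g A (\<epsilon>f k) (\<beta> k) (x k))) \<and>
         (iALM_iterates (second_order_solver f g A) A k1 \<beta> \<epsilon> \<sigma> x y \<and>
          (\<forall>b>0. \<forall>u z. (\<lambda>w. grad_AL f A b w u) differentiable (at z)) \<longrightarrow>
           (\<forall>k\<in>K. second_order_stationary f A (\<epsilon>f k) (\<epsilon>s k) (\<beta> k) (x k) \<and>
             \<epsilon>s k = (\<nu> + \<sigma> k * sqrt (real CARD('m)) * lA * (2 * lf' + 2 * lA' * ymax))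
                       / (\<nu> * \<beta> (k - 1))))"
proof -
  let ?J = "\<lambda>z. jacobian A (at z)"
  define B where "B = lf' + lA' * ymax"
  have k0: "k0 \<in> K" using K_bounds by (simp add: K_def)
  have x_le: "norm (x k) \<le> \<rho>" if "k \<in> K" for k
    unfolding rho_def using that by (rule cSUP_upper[OF _ rho_finite])
  then have rho: "0 \<le> \<rho>" using k0 norm_ge_zero order_trans by blast
  have lf': "norm (gradient f z) \<le> lf'" if "norm z \<le> \<rho>" for z
  proof -
    \<comment> \<open>Comparison with the value at 0 gives boundedness on the ball, without which
      the \<open>SUP\<close> defining \<open>lf'\<close> need not be an upper bound. The same
      argument serves \<open>lA'\<close>.\<close>
    have "norm (gradient f z) \<le> norm (gradient f 0) + lf * \<rho>" if "norm z \<le> \<rho>" for z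
      using Lipschitz_f[of z 0] norm_triangle_sub[of "gradient f z" "gradient f 0"]
        mult_left_mono[OF that Lipschitz_nonneg(1)] by simp
    then have "bdd_above ((\<lambda>z. norm (gradient f z)) ` cball 0 \<rho>)"
      by (auto intro!: bdd_aboveI2)
    then show ?thesis unfolding lf'_eq using that by (intro cSUP_upper) simp_all
  qed
  have lA': "spectral_norm (?J z) \<le> lA'" if "norm z \<le> \<rho>" for z
  proof -
    have "spectral_norm (?J z) \<le> spectral_norm (?J 0) + lA * \<rho>" if "norm z \<le> \<rho>" for z
      using Lipschitz_A[of z 0] spectral_norm_triangle[of "?J z" "?J 0"]
        mult_left_mono[OF that Lipschitz_nonneg(2)] by simp
    then have "bdd_above ((\<lambda>z. spectral_norm (?J z)) ` cball 0 \<rho>)"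
      by (auto intro!: bdd_aboveI2)
    then show ?thesis unfolding lA'_eq using that by (intro cSUP_upper) simp_all
  qed
  have lf'_nonneg: "0 \<le> lf'" and lA'_nonneg: "0 \<le> lA'"
    using order_trans[OF norm_ge_zero lf'[of 0]] order_trans[OF spectral_norm_nonneg lA'[of 0]] rho
    by simp_all
  have "0 \<le> S" unfolding S_def using sum_inverse_nat_ln_square_le_infsum[of 0] by simp
  then have ymax_nonneg: "0 \<le> ymax" using c_ge by (simp add: ymax_def)
  then have B: "0 \<le> B" using lf'_nonneg lA'_nonneg by (simp add: B_def)

  \<comment> \<open>Stated for any solver that guarantees the first-order residual bound, so that
    both claims can instantiate it.\<close>
  have main: "\<beta> (k - 1) > 0 \<and> \<beta> (k - 1) \<le> \<beta> k \<and> \<epsilon> k = 1 / \<beta> (k - 1) \<and> 0 \<le> \<sigma> k \<and>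
      solver (\<beta> (k - 1)) (y (k - 1)) (\<epsilon> k) (x k) \<and>
      \<epsilon> k \<le> \<epsilon>f k \<and> norm (A (x k)) \<le> \<epsilon>f k"
    if iter: "iALM_iterates solver A k1 \<beta> \<epsilon> \<sigma> x y"
      and res: "\<And>b u e z. solver b u e z \<Longrightarrow> stationarity_residual_le f g A b z u e"
      and kK: "k \<in> K" for k solver
  proof -
    define j where "j = k - 1"
    have j: "k = j + 1" "1 \<le> j" and k1: "enat (j + 1) \<le> k1" and k0j: "k0 - 1 \<le> j"
      using kK K_bounds by (auto simp: K_def j_def)
    have pos: "\<beta> i > 0" if "1 \<le> i" for i using iter that by (auto simp: iALM_iterates_def)
    have mono: "\<beta> i \<le> \<beta> i'" if "1 \<le> i" "i \<le> i'" for i i'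
      using iter that by (auto simp: iALM_iterates_def intro: mono_onD)
    have \<sigma>1: "\<sigma> 1 > 0" using iter by (simp add: iALM_iterates_def)
    have \<epsilon>k: "\<epsilon> k = 1 / \<beta> j" and sol: "solver (\<beta> j) (y j) (\<epsilon> k) (x k)"
      and \<sigma>k: "\<sigma> k = \<sigma> 1 * dual_step_factor A x j"
      using iter j k1 by (auto simp: iALM_iterates_def)
    have \<sigma>k_nonneg: "0 \<le> \<sigma> k" using \<sigma>1 by (simp add: \<sigma>k dual_step_factor_nonneg)
    have "norm (y j) \<le> norm (y 0) + \<sigma> 1 * (ln 2)\<^sup>2 * norm (A (x 1)) * S"
    proof -
      have "enat j \<le> k1" using k1 by (meson enat_ord_simps(1) le_add1 order_trans)
      from iALM_multiplier_bound[OF iter j(2) this] show ?thesis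
        unfolding S_def
        by (rule order_trans[OF _ add_left_mono[OF
              mult_left_mono[OF sum_inverse_nat_ln_square_le_infsum]]]) (use \<sigma>1 in simp)
    qed
    \<comment> \<open>The multipliers accumulate the constant
      \<open>\<sigma> 1 * (ln 2)^2 * S\<close>, which \<open>c_dual_step\<close> compares with
      \<open>c\<close>.\<close>
    also have "\<dots> \<le> ymax"
      unfolding ymax_def using mult_right_mono[OF c_dual_step norm_ge_zero[of "A (x 1)"]]
      by (simp add: mult_ac)
    finally have yj: "norm (y j) \<le> ymax" .
    have "spectral_norm (?J (x k)) * norm (y j) \<le> lA' * ymax"
      using lA' x_le kK yj lA'_nonneg by (intro mult_mono) auto
    moreover have "norm (gradient f (x k)) \<le> lf'" using lf' x_le kK by simp
    \<comment> \<open>Monotonicity of \<open>\<beta>\<close> carries \<open>k0_large\<close> to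
      every later index; \<open>k0 \<ge> 2\<close> keeps \<open>k0 - 1\<close> in the range where
      \<open>\<beta>\<close> is monotone. Adding this to the bound \<open>B\<close> for the other
      two terms produces the factor 2 in \<open>\<epsilon>f\<close>.\<close>
    moreover have "1 / \<beta> j \<le> B + \<nu>"
    proof -
      have "1 \<le> k0 - 1" using K_bounds by simp
      then have "1 / \<beta> j \<le> 1 / \<beta> (k0 - 1)"
        using pos mono k0j by (simp add: frac_le)
      then show ?thesis using k0_large by (simp add: B_def)
    qed
    ultimately have "norm (gradient f (x k)) + spectral_norm (?J (x k)) * norm (y j) + \<epsilon> k
        \<le> 2 * B + \<nu>"
      by (simp add: \<epsilon>k B_def)
    moreover have "\<nu> * norm (A (x k)) \<le>
        (norm (gradient f (x k)) + spectral_norm (?J (x k)) * norm (y j) + \<epsilon> k) / \<beta> j"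
      using regularity[OF kK] res[OF sol] pos[OF j(2)] f_C1(1) A_diff
      by (intro feasibility_from_regularity) (simp_all add: j(1))
    ultimately have "\<nu> * norm (A (x k)) \<le> (2 * B + \<nu>) / \<beta> j"
      using pos[OF j(2)] by (meson divide_right_mono less_imp_le order_trans)
    then have "norm (A (x k)) \<le> 1 / \<beta> j * (2 * B / \<nu> + 1)"
      using nu_pos pos[OF j(2)] by (simp add: field_simps)
    also have "\<dots> \<le> \<epsilon>f k"
    proof -
      \<comment> \<open>Feasibility holds with factor 1; the factor in \<open>\<epsilon>f\<close> is
        at least as large because \<open>lA'\<close> and \<open>\<sigma> k\<close> are
        nonnegative.\<close>
      have "2 * B * 1 \<le> 2 * B * (1 + lA' * \<sigma> k)"
        using B lA'_nonneg \<sigma>k_nonneg by (intro mult_left_mono) auto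
      then show ?thesis
        unfolding ef_def B_def[symmetric] j_def[symmetric] using nu_pos pos[OF j(2)]
        by (intro mult_left_mono add_right_mono) (simp_all add: divide_right_mono)
    qed
    finally have "norm (A (x k)) \<le> \<epsilon>f k" .
    \<comment> \<open>The solver tolerance \<open>1 / \<beta> j\<close> is exactly the
      \<open>+ 1\<close> summand of \<open>\<epsilon>f k\<close>.\<close>
    moreover have "\<epsilon> k \<le> \<epsilon>f k"
    proof -
      have "0 \<le> 2 * B * (1 + lA' * \<sigma> k) / \<nu>"
        using B lA'_nonneg \<sigma>k_nonneg nu_pos by simp
      then have "1 / \<beta> j * 1 \<le> 1 / \<beta> j * (2 * B * (1 + lA' * \<sigma> k) / \<nu> + 1)"
        using pos[OF j(2)] by (intro mult_left_mono) auto
      then show ?thesis unfolding ef_def B_def[symmetric] j_def[symmetric] \<epsilon>k by simp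
    qed
    ultimately show ?thesis
      using pos[OF j(2)] mono[of j k] \<epsilon>k sol \<sigma>k_nonneg j by simp
  qed

  have residual: "stationarity_residual_le f g A (\<beta> k) (x k)
      (y (k - 1) + (\<beta> (k - 1) - \<beta> k) *\<^sub>R A (x k)) (\<epsilon>f k)"
    if "stationarity_residual_le f g A (\<beta> (k - 1)) (x k) (y (k - 1)) (\<epsilon> k)" "\<epsilon> k \<le> \<epsilon>f k" for k
    using that unfolding stationarity_residual_shift[OF f_C1(1) A_diff]
    by (auto simp: stationarity_residual_le_def)

  have first: "first_order_stationary f g A (\<epsilon>f k) (\<beta> k) (x k)"
    if "iALM_iterates (first_order_solver f g A) A k1 \<beta> \<epsilon> \<sigma> x y" "k \<in> K" for k
    using main[OF that(1) _ that(2)] residual[of k]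
    unfolding first_order_stationary_def first_order_solver_def by blast

  have second: "second_order_stationary f A (\<epsilon>f k) (\<epsilon>s k) (\<beta> k) (x k) \<and>
      \<epsilon>s k = (\<nu> + \<sigma> k * sqrt (real CARD('m)) * lA * (2 * lf' + 2 * lA' * ymax))
        / (\<nu> * \<beta> (k - 1))"
    if iter: "iALM_iterates (second_order_solver f g A) A k1 \<beta> \<epsilon> \<sigma> x y"
      and twice: "\<And>b u z. b > 0 \<Longrightarrow> (\<lambda>w. grad_AL f A b w u) differentiable (at z)"
      and kK: "k \<in> K" for k
  proof -
    from main[OF iter _ kK]
    have pos: "\<beta> (k - 1) > 0" and le: "\<beta> (k - 1) \<le> \<beta> k" and \<epsilon>k: "\<epsilon> k = 1 / \<beta> (k - 1)"
      and \<sigma>k: "0 \<le> \<sigma> k"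
      and sol: "second_order_solver f g A (\<beta> (k - 1)) (y (k - 1)) (\<epsilon> k) (x k)"
      and ef: "\<epsilon> k \<le> \<epsilon>f k" "norm (A (x k)) \<le> \<epsilon>f k"
      by (auto simp: second_order_solver_def)
    \<comment> \<open>One multiplier has to witness the residual and the eigenvalue bound
      simultaneously.\<close>
    let ?y = "y (k - 1) + (\<beta> (k - 1) - \<beta> k) *\<^sub>R A (x k)"
    have "- \<epsilon> k \<le> min_eigenvalue (hess_AL f A (\<beta> k) (x k) ?y)"
      using sol pos le
      by (intro min_eigenvalue_hess_AL_shift[OF f_C1(1) A_diff Lipschitz_A twice twice])
         (auto simp: second_order_solver_def)
    \<comment> \<open>\<open>\<epsilon>s k\<close> adds to \<open>\<epsilon> k\<close> a product of
      nonnegative factors.\<close>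
    moreover have "\<epsilon> k \<le> \<epsilon>s k"
      unfolding es_def using \<sigma>k Lipschitz_nonneg lf'_nonneg lA'_nonneg ymax_nonneg nu_pos pos by simp
    ultimately have "- \<epsilon>s k \<le> min_eigenvalue (hess_AL f A (\<beta> k) (x k) ?y)" by simp
    moreover have "stationarity_residual_le f (\<lambda>_. 0) A (\<beta> k) (x k) ?y (\<epsilon>f k)"
      using residual[of k] sol ef(1) by (auto simp: second_order_solver_def)
    ultimately have "second_order_stationary f A (\<epsilon>f k) (\<epsilon>s k) (\<beta> k) (x k)"
      using ef(2) unfolding second_order_stationary_def by blast
    moreover have "\<epsilon>s k = (\<nu> + \<sigma> k * sqrt (real CARD('m)) * lA * (2 * lf' + 2 * lA' * ymax))
        / (\<nu> * \<beta> (k - 1))"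
      unfolding es_def \<epsilon>k using nu_pos pos by (simp add: field_simps)
    ultimately show ?thesis by blast
  qed
  show ?thesis using first second by blast
qed


end
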